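(* Let $(S^2,g_0)$ be the round unit sphere in $\mathbb R^3$, let $\xi=x^3|_{S^2}$, let $\lambda\in\mathbb R$ be fixed and $\alpha(t)=e^{\lambda t}$. Let $u=u(x,t)$ be defined by $$g(t)=e^{2u}g_0=\varphi_{\alpha(t)}^*g_0=\left[\frac{2\alpha(t)}{(1+\xi)+\alpha(t)^2(1-\xi)}\right]^2g_0 .$$ Then the path $u:(-\infty,+\infty)\to\Gamma_1^+$ is a geodesic.
   Context: $\varphi_\alpha=\sigma^{-1}\circ\delta_\alpha\circ\sigma:S^2\to S^2$, where $\sigma:S^2\setminus\{N\}\to\mathbb R^2$ is stereographic projection from the north pole $N$ and $\delta_\alpha(x)=\alpha^{-1}x$ is the dilation of the plane. For $u\in C^\infty(S^2)$, $g_u=e^{2u}g_0$ has Gauss curvature $K_u$, and $\Gamma_1^+=\{u\in C^\infty(S^2):K_u>0\}$. A path $u$ in $\Gamma_1^+$ is a geodesic if $$\frac{\partial^2u}{\partial t^2}+\frac1{K_u}\Big|\nabla_u\frac{\partial u}{\partial t}\Big|_u^2=0,$$ gradient and norm being those of $g_u$; this is the geodesic equation of the formal Riemannian metric $\langle\langle\alpha,\beta\rangle\rangle_u=\int\alpha\beta K_u\,dA_u$. *)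

theory Defs
  imports "HOL-Analysis.Analysis"
begin

text \<open>Functions on the two-sphere are represented by total functions on \<open>real ^ 3\<close>;
  every notion below depends only on their values on \<open>S2\<close>.\<close>

abbreviation S2 :: "(real ^ 3) set" where
  "S2 \<equiv> sphere 0 1"

definition north :: "real ^ 3" where
  "north = axis 3 1"

definition xi :: "real ^ 3 \<Rightarrow> real" where
  "xi p = p $ 3"

definition tangent_space :: "real ^ 3 \<Rightarrow> (real ^ 3) set" where
  "tangent_space p = {v. v \<bullet> p = 0}"


definition stereo :: "real ^ 3 \<Rightarrow> real ^ 2" where
  "stereo p = vector [p $ 1 / (1 - p $ 3), p $ 2 / (1 - p $ 3)]"

definition stereo_inv :: "real ^ 2 \<Rightarrow> real ^ 3" where
  "stereo_inv = inv_into (S2 - {north}) stereo"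

definition dilation :: "real \<Rightarrow> real ^ 2 \<Rightarrow> real ^ 2" where
  "dilation a x = inverse a *\<^sub>R x"

text \<open>The composite is undefined at the north pole, which corresponds to the point at infinity
  of the plane and is fixed by the extension of the dilation.\<close>

definition conf_map :: "real \<Rightarrow> real ^ 3 \<Rightarrow> real ^ 3" where
  "conf_map a p = (if p = north then north else stereo_inv (dilation a (stereo p)))"

text \<open>The two inverse stereographic projections, from the north and from the south pole,
  form an atlas of \<open>S2\<close>.\<close>

definition reflect :: "real ^ 3 \<Rightarrow> real ^ 3" where
  "reflect p = vector [p $ 1, p $ 2, - p $ 3]"

definition stereo_inv_south :: "real ^ 2 \<Rightarrow> real ^ 3" where
  "stereo_inv_south y = reflect (stereo_inv y)"


primrec Ck_on :: "nat \<Rightarrow> 'a::real_normed_vector set \<Rightarrow> ('a \<Rightarrow> 'b::real_normed_vector) \<Rightarrow> bool"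
  where
    "Ck_on 0 S f \<longleftrightarrow> continuous_on S f"
  | "Ck_on (Suc k) S f \<longleftrightarrow>
      (\<forall>x\<in>S. f differentiable (at x)) \<and>
      (\<forall>v. Ck_on k S (\<lambda>x. frechet_derivative f (at x) v))"

definition smooth :: "('a::real_normed_vector \<Rightarrow> 'b::real_normed_vector) \<Rightarrow> bool" where
  "smooth f \<longleftrightarrow> (\<forall>k. Ck_on k UNIV f)"

definition smooth_S2 :: "(real ^ 3 \<Rightarrow> real) \<Rightarrow> bool" where
  "smooth_S2 f \<longleftrightarrow> smooth (f \<circ> stereo_inv) \<and> smooth (f \<circ> stereo_inv_south)"

text \<open>For \<open>v\<close> tangent to \<open>S2\<close> at \<open>p\<close>, the curve \<open>s \<mapsto> sgn (p + s v) = (p + s v) / norm (p + s v)\<close> lies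
  in \<open>S2\<close>, passes through \<open>p\<close> at \<open>s = 0\<close> and has velocity \<open>v\<close> there.\<close>

definition differential :: "(real ^ 3 \<Rightarrow> 'b::real_normed_vector) \<Rightarrow> real ^ 3 \<Rightarrow> real ^ 3 \<Rightarrow> 'b" where
  "differential f p v = vector_derivative (\<lambda>s. f (sgn (p + s *\<^sub>R v))) (at 0)"


text \<open>A Riemannian metric on \<open>S2\<close> is a family \<open>g p v w\<close>, relevant only for \<open>p\<close> on \<open>S2\<close> and
  \<open>v\<close>, \<open>w\<close> tangent at \<open>p\<close>.\<close>

type_synonym metric_S2 = "real ^ 3 \<Rightarrow> real ^ 3 \<Rightarrow> real ^ 3 \<Rightarrow> real"

definition metric_eq :: "metric_S2 \<Rightarrow> metric_S2 \<Rightarrow> bool" where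
  "metric_eq g h \<longleftrightarrow> (\<forall>p\<in>S2. \<forall>v\<in>tangent_space p. \<forall>w\<in>tangent_space p. g p v w = h p v w)"

definition g0 :: metric_S2 where
  "g0 p v w = v \<bullet> w"

definition scale_metric :: "(real ^ 3 \<Rightarrow> real) \<Rightarrow> metric_S2 \<Rightarrow> metric_S2" where
  "scale_metric f g p v w = f p * g p v w"

definition conf_metric :: "(real ^ 3 \<Rightarrow> real) \<Rightarrow> metric_S2" where
  "conf_metric u = scale_metric (\<lambda>p. exp (2 * u p)) g0"

definition pullback :: "(real ^ 3 \<Rightarrow> real ^ 3) \<Rightarrow> metric_S2 \<Rightarrow> metric_S2" where
  "pullback \<phi> g p v w = g (\<phi> p) (differential \<phi> p v) (differential \<phi> p w)"

definition gradient :: "metric_S2 \<Rightarrow> (real ^ 3 \<Rightarrow> real) \<Rightarrow> real ^ 3 \<Rightarrow> real ^ 3" where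
  "gradient g f p =
    (THE X. X \<in> tangent_space p \<and> (\<forall>w\<in>tangent_space p. g p X w = differential f p w))"


definition partial :: "2 \<Rightarrow> (real ^ 2 \<Rightarrow> 'b::real_normed_vector) \<Rightarrow> real ^ 2 \<Rightarrow> 'b" where
  "partial k f y = frechet_derivative f (at y) (axis k 1)"

definition local_metric :: "metric_S2 \<Rightarrow> (real ^ 2 \<Rightarrow> real ^ 3) \<Rightarrow> real ^ 2 \<Rightarrow> real ^ 2 ^ 2" where
  "local_metric g X y = (\<chi> i j. g (X y) (partial i X y) (partial j X y))"

text \<open>\<open>christoffel G m i j\<close> is the symbol with upper index \<open>m\<close> and lower indices \<open>i\<close>, \<open>j\<close>.\<close>

definition christoffel :: "(real ^ 2 \<Rightarrow> real ^ 2 ^ 2) \<Rightarrow> 2 \<Rightarrow> 2 \<Rightarrow> 2 \<Rightarrow> real ^ 2 \<Rightarrow> real" where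
  "christoffel G m i j y =
    (\<Sum>l\<in>UNIV. matrix_inv (G y) $ m $ l *
      (partial i (\<lambda>z. G z $ j $ l) y + partial j (\<lambda>z. G z $ i $ l) y
        - partial l (\<lambda>z. G z $ i $ j) y)) / 2"

text \<open>The \<open>l\<close>-th component of \<open>R(\<partial>\<^sub>i, \<partial>\<^sub>j) \<partial>\<^sub>k\<close>, with the convention
  \<open>R(X, Y) Z = \<nabla>\<^sub>X \<nabla>\<^sub>Y Z - \<nabla>\<^sub>Y \<nabla>\<^sub>X Z - \<nabla>\<^bsub>[X, Y]\<^esub> Z\<close>.\<close>

definition riemann :: "(real ^ 2 \<Rightarrow> real ^ 2 ^ 2) \<Rightarrow> 2 \<Rightarrow> 2 \<Rightarrow> 2 \<Rightarrow> 2 \<Rightarrow> real ^ 2 \<Rightarrow> real" where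
  "riemann G i j k l y =
    partial i (christoffel G l j k) y - partial j (christoffel G l i k) y
    + (\<Sum>m\<in>UNIV. christoffel G m j k y * christoffel G l i m y
               - christoffel G m i k y * christoffel G l j m y)"

text \<open>\<open>g(R(\<partial>\<^sub>1, \<partial>\<^sub>2) \<partial>\<^sub>2, \<partial>\<^sub>1) / det g\<close>, which is \<open>1\<close> for the round unit sphere.\<close>

definition local_curvature :: "(real ^ 2 \<Rightarrow> real ^ 2 ^ 2) \<Rightarrow> real ^ 2 \<Rightarrow> real" where
  "local_curvature G y = (\<Sum>l\<in>UNIV. G y $ 1 $ l * riemann G 1 2 2 l y) / det (G y)"

text \<open>Gauss curvature does not depend on the coordinates used to compute it, so one chart per
  point suffices.\<close>

definition gauss_curvature :: "metric_S2 \<Rightarrow> real ^ 3 \<Rightarrow> real" where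
  "gauss_curvature g p =
    (if p = north then local_curvature (local_metric g stereo_inv_south) (stereo (reflect p))
     else local_curvature (local_metric g stereo_inv) (stereo p))"


definition Gamma1_plus :: "(real ^ 3 \<Rightarrow> real) set" where
  "Gamma1_plus = {u. smooth_S2 u \<and> (\<forall>p\<in>S2. gauss_curvature (conf_metric u) p > 0)}"

text \<open>Paths are smooth jointly in the point of \<open>S2\<close> and the time.\<close>

definition path_in_Gamma1_plus :: "(real \<Rightarrow> real ^ 3 \<Rightarrow> real) \<Rightarrow> bool" where
  "path_in_Gamma1_plus u \<longleftrightarrow>
    (\<forall>t. u t \<in> Gamma1_plus) \<and>
    smooth (\<lambda>(y, t). u t (stereo_inv y)) \<and> smooth (\<lambda>(y, t). u t (stereo_inv_south y))"

definition time_deriv :: "(real \<Rightarrow> real ^ 3 \<Rightarrow> real) \<Rightarrow> real \<Rightarrow> real ^ 3 \<Rightarrow> real" where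
  "time_deriv u t p = deriv (\<lambda>s. u s p) t"

definition geodesic_Gamma1_plus :: "(real \<Rightarrow> real ^ 3 \<Rightarrow> real) \<Rightarrow> bool" where
  "geodesic_Gamma1_plus u \<longleftrightarrow>
    path_in_Gamma1_plus u \<and>
    (\<forall>t. \<forall>p\<in>S2.
      (let g = conf_metric (u t); X = gradient g (time_deriv u t) p
       in time_deriv (time_deriv u) t p + 1 / gauss_curvature g p * g p X X = 0))"

end

theory Submission
  imports Defs
begin

text \<open>
  In closed form, \<open>u = ln 2 + ln \<alpha> - ln D\<close> with \<open>D = (1 + \<xi>) + \<alpha>\<^sup>2 (1 - \<xi>)\<close>. In either stereographic
  chart the metric \<open>exp (2 u) g\<^sub>0\<close> becomes \<open>4 b\<^sup>2 |dy|\<^sup>2 / (b\<^sup>2 + |y|\<^sup>2)\<^sup>2\<close> with \<open>b = \<alpha>\<close> or \<open>b = 1 / \<alpha>\<close>,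
  which has curvature \<open>1\<close>. The velocity \<open>u\<^sub>t = \<lambda> (1 + \<xi> - \<alpha>\<^sup>2 (1 - \<xi>)) / D\<close> is a function of \<open>\<xi>\<close>
  whose derivative in \<open>\<xi>\<close> is \<open>4 \<lambda> \<alpha>\<^sup>2 / D\<^sup>2\<close>, and the round gradient of \<open>\<xi>\<close> has squared norm \<open>1 - \<xi>\<^sup>2\<close>.
  Hence the squared gradient of \<open>u\<^sub>t\<close> is \<open>4 \<lambda>\<^sup>2 \<alpha>\<^sup>2 (1 - \<xi>\<^sup>2) / D\<^sup>2 = - u\<^sub>t\<^sub>t\<close>.
\<close>

subsection \<open>Elementary functions are smooth\<close>

text \<open>The point of this class is that it is closed under directional derivatives, which makes its
  members smooth by induction on the order.\<close>

inductive elementary :: "('a::real_normed_vector \<Rightarrow> real) \<Rightarrow> bool" where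
  const: "elementary (\<lambda>x. c)"
| linear: "bounded_linear f \<Longrightarrow> elementary f"
| add: "elementary f \<Longrightarrow> elementary g \<Longrightarrow> elementary (\<lambda>x. f x + g x)"
| mult: "elementary f \<Longrightarrow> elementary g \<Longrightarrow> elementary (\<lambda>x. f x * g x)"
| inverse: "elementary f \<Longrightarrow> (\<And>x. f x \<noteq> 0) \<Longrightarrow> elementary (\<lambda>x. inverse (f x))"
| exp: "elementary f \<Longrightarrow> elementary (\<lambda>x. exp (f x))"
| ln: "elementary f \<Longrightarrow> (\<And>x. f x > 0) \<Longrightarrow> elementary (\<lambda>x. ln (f x))"

lemma elementary_minus: "elementary f \<Longrightarrow> elementary (\<lambda>x. - f x)"
  using elementary.mult[OF elementary.const[of "-1"]] by simp

lemma elementary_diff: "elementary f \<Longrightarrow> elementary g \<Longrightarrow> elementary (\<lambda>x. f x - g x)"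
  using elementary.add[OF _ elementary_minus] by simp

text \<open>One family \<open>f'\<close> carries both claims through the induction: the rules for
  products, inverses, \<open>exp\<close> and \<open>ln\<close> build the new derivative from the old
  functions and derivatives, so it stays in the class.\<close>

lemma elementary_has_derivative:
  assumes "elementary f"
  shows "\<exists>f'. (\<forall>x. (f has_derivative f' x) (at x)) \<and> (\<forall>v. elementary (\<lambda>x. f' x v))"
  using assms
proof induction
  case (const c)
  then show ?case
    by (intro exI[of _ "\<lambda>_ _. 0"]) (auto intro: elementary.const)
next
  case (linear f)
  then show ?case
    by (intro exI[of _ "\<lambda>_. f"]) (auto intro: elementary.const bounded_linear_imp_has_derivative)
next
  case (add f g)
  then obtain f' g' where
    "\<And>x. (f has_derivative f' x) (at x)" "\<And>x. (g has_derivative g' x) (at x)"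
    "\<And>v. elementary (\<lambda>x. f' x v)" "\<And>v. elementary (\<lambda>x. g' x v)"
    by metis
  then show ?case
    by (intro exI[of _ "\<lambda>x v. f' x v + g' x v"])
       (auto intro: elementary.intros has_derivative_add)
next
  case (mult f g)
  then obtain f' g' where
    "\<And>x. (f has_derivative f' x) (at x)" "\<And>x. (g has_derivative g' x) (at x)"
    "\<And>v. elementary (\<lambda>x. f' x v)" "\<And>v. elementary (\<lambda>x. g' x v)"
    by metis
  with mult.hyps show ?case
    by (intro exI[of _ "\<lambda>x v. f x * g' x v + f' x v * g x"])
       (auto intro!: elementary.add elementary.mult has_derivative_mult)
next
  case (inverse f)
  then obtain f' where
    "\<And>x. (f has_derivative f' x) (at x)" "\<And>v. elementary (\<lambda>x. f' x v)"
    by metis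
  with inverse.hyps show ?case
    by (intro exI[of _ "\<lambda>x v. - (inverse (f x) * f' x v * inverse (f x))"])
       (auto intro!: elementary.mult elementary.inverse elementary_minus Deriv.has_derivative_inverse)
next
  case (exp f)
  then obtain f' where
    "\<And>x. (f has_derivative f' x) (at x)" "\<And>v. elementary (\<lambda>x. f' x v)"
    by metis
  with exp.hyps show ?case
    by (intro exI[of _ "\<lambda>x v. f' x v * exp (f x)"])
       (auto intro!: elementary.mult elementary.exp derivative_eq_intros)
next
  case (ln f)
  then obtain f' where
    "\<And>x. (f has_derivative f' x) (at x)" "\<And>v. elementary (\<lambda>x. f' x v)"
    by metis
  with ln.hyps show ?case
    by (intro exI[of _ "\<lambda>x v. f' x v * inverse (f x)"])
       (auto intro!: elementary.mult elementary.inverse has_derivative_ln simp: less_imp_neq[symmetric])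
qed

text \<open>The induction lets \<open>f\<close> vary, since its step applies the hypothesis to the
  directional derivatives of \<open>f\<close>.\<close>

lemma elementary_Ck: "elementary f \<Longrightarrow> Ck_on k UNIV f"
proof (induction k arbitrary: f)
  case 0
  then obtain f' where "\<And>x. (f has_derivative f' x) (at x)"
    using elementary_has_derivative by blast
  then show ?case
    by (auto intro!: continuous_at_imp_continuous_on has_derivative_continuous)
next
  case (Suc k)
  then obtain f' where f': "\<And>x. (f has_derivative f' x) (at x)" "\<And>v. elementary (\<lambda>x. f' x v)"
    using elementary_has_derivative by metis
  from f'(1) have "frechet_derivative f (at x) = f' x" for x
    by (metis frechet_derivative_at)
  with f' Suc.IH show ?case
    by (auto simp: differentiable_def)
qed

lemma elementary_smooth: "elementary f \<Longrightarrow> smooth f"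
  unfolding smooth_def by (blast intro: elementary_Ck)

subsection \<open>Stereographic projection\<close>

lemma sphere3_iff: "p \<in> S2 \<longleftrightarrow> (p $ 1)\<^sup>2 + (p $ 2)\<^sup>2 + (p $ 3)\<^sup>2 = 1"
  by (simp add: norm_eq_1 inner_vec_def sum_3 power2_eq_square)

text \<open>The factored form lets \<open>1 - p $ 3\<close> cancel against the denominators of
  \<open>stereo\<close>.\<close>

lemma sphere3_horizontal: "p \<in> S2 \<Longrightarrow> (p $ 1)\<^sup>2 + (p $ 2)\<^sup>2 = (1 - p $ 3) * (1 + p $ 3)"
  unfolding sphere3_iff by (simp add: algebra_simps power2_eq_square)

lemma sphere3_xi_bounds: "p \<in> S2 \<Longrightarrow> - 1 \<le> p $ 3 \<and> p $ 3 \<le> 1"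
  using component_le_norm_cart[of p 3] by (auto simp: abs_le_iff)

lemma eq_north_iff:
  assumes "p \<in> S2"
  shows "p = north \<longleftrightarrow> p $ 3 = 1"
proof
  assume "p $ 3 = 1"
  with assms have "(p $ 1)\<^sup>2 + (p $ 2)\<^sup>2 = 0" by (simp add: sphere3_iff del: mem_sphere mem_sphere_0)
  with \<open>p $ 3 = 1\<close> show "p = north"
    by (simp add: north_def axis_def vec_eq_iff forall_3 sum_power2_eq_zero_iff)
qed (simp add: north_def axis_def)

text \<open>\<open>e = 1\<close> gives the inverse projection from the north pole, \<open>e = - 1\<close> that from the south
  pole.\<close>

definition chart :: "real \<Rightarrow> real ^ 2 \<Rightarrow> real ^ 3" where
  "chart e y =
    (2 * y $ 1 / (1 + (y $ 1)\<^sup>2 + (y $ 2)\<^sup>2)) *\<^sub>R axis 1 1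
    + (2 * y $ 2 / (1 + (y $ 1)\<^sup>2 + (y $ 2)\<^sup>2)) *\<^sub>R axis 2 1
    + (e * (1 - 2 / (1 + (y $ 1)\<^sup>2 + (y $ 2)\<^sup>2))) *\<^sub>R axis 3 1"

lemma chart_nth:
  "chart e y $ 1 = 2 * y $ 1 / (1 + (y $ 1)\<^sup>2 + (y $ 2)\<^sup>2)"
  "chart e y $ 2 = 2 * y $ 2 / (1 + (y $ 1)\<^sup>2 + (y $ 2)\<^sup>2)"
  "chart e y $ 3 = e * (1 - 2 / (1 + (y $ 1)\<^sup>2 + (y $ 2)\<^sup>2))"
  by (simp_all add: chart_def axis_def)

lemma sum_squares_pos: "0 < 1 + x\<^sup>2 + (y::real)\<^sup>2"
  by (simp add: add_pos_nonneg)

lemma chart_in_sphere: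
  assumes "e\<^sup>2 = 1"
  shows "chart e y \<in> S2"
proof -
  define q where "q = 1 + (y $ 1)\<^sup>2 + (y $ 2)\<^sup>2"
  have "q \<noteq> 0" using sum_squares_pos[of "y $ 1" "y $ 2"] by (simp add: q_def)
  have "(2 * y $ 1 / q)\<^sup>2 + (2 * y $ 2 / q)\<^sup>2 = 4 * (q - 1) / q\<^sup>2"
    by (simp add: q_def power_divide power_mult_distrib add_divide_distrib)
  moreover have "(e * (1 - 2 / q))\<^sup>2 = (q - 2)\<^sup>2 / q\<^sup>2"
    using \<open>q \<noteq> 0\<close> by (simp add: power_mult_distrib assms diff_divide_distrib flip: power_divide)
  moreover have "4 * (q - 1) / q\<^sup>2 + (q - 2)\<^sup>2 / q\<^sup>2 = 1"
    using \<open>q \<noteq> 0\<close> by (simp add: power2_eq_square field_simps)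
  ultimately show ?thesis
    unfolding sphere3_iff chart_nth by (simp flip: q_def)
qed

lemma stereo_nth:
  "stereo p $ 1 = p $ 1 / (1 - p $ 3)" "stereo p $ 2 = p $ 2 / (1 - p $ 3)"
  by (simp_all add: stereo_def)

lemma stereo_chart: "stereo (chart 1 y) = y"
  using sum_squares_pos[of "y $ 1" "y $ 2"]
  by (simp add: vec_eq_iff forall_2 stereo_nth chart_nth)

lemma chart_stereo:
  assumes "p \<in> S2" "p \<noteq> north"
  shows "chart 1 (stereo p) = p"
proof -
  have nz: "1 - p $ 3 \<noteq> 0" using assms eq_north_iff by auto
  from sphere3_horizontal[OF assms(1)] have "1 + (stereo p $ 1)\<^sup>2 + (stereo p $ 2)\<^sup>2 = 1 + (1 + p $ 3) / (1 - p $ 3)"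
    using nz by (simp add: stereo_nth power_divide add.assoc power2_eq_square flip: add_divide_distrib)
  also have "\<dots> = 2 / (1 - p $ 3)"
    using nz by (simp add: field_simps)
  finally have "1 + (stereo p $ 1)\<^sup>2 + (stereo p $ 2)\<^sup>2 = 2 / (1 - p $ 3)" .
  with nz show ?thesis
    by (simp add: vec_eq_iff forall_3 chart_nth stereo_nth diff_divide_distrib)
qed

lemma chart_ne_north: "chart 1 y \<noteq> north"
proof -
  have "chart 1 y $ 3 \<noteq> 1"
    using sum_squares_pos[of "y $ 1" "y $ 2"] by (simp add: chart_nth)
  then show ?thesis by (auto simp: north_def axis_def)
qed

lemma stereo_inv_eq: "stereo_inv = chart 1"
proof
  fix y
  have "inj_on stereo (S2 - {north})"
    by (rule inj_on_inverseI[of _ "chart 1"]) (auto intro: chart_stereo)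
  moreover have "chart 1 y \<in> S2 - {north}"
    using chart_in_sphere[of 1] chart_ne_north by simp
  ultimately show "stereo_inv y = chart 1 y"
    unfolding stereo_inv_def using inv_into_f_f[of stereo _ "chart 1 y"] by (simp add: stereo_chart)
qed

lemma stereo_inv_south_eq: "stereo_inv_south = chart (- 1)"
  by (simp add: fun_eq_iff stereo_inv_south_def reflect_def stereo_inv_eq vec_eq_iff forall_3 chart_nth)

section \<open>The round metric in the two charts\<close>

lemmas has_derivative_vec_nth [derivative_intros] =
  bounded_linear.has_derivative[OF bounded_linear_vec_nth]

lemma has_vector_derivative_vec_nth [derivative_intros]:
  "(f has_vector_derivative f') F \<Longrightarrow> ((\<lambda>x. f x $ i) has_vector_derivative f' $ i) F"
  by (rule bounded_linear.has_vector_derivative[OF bounded_linear_vec_nth])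

lemma partial_eqI: "(f has_derivative f') (at y) \<Longrightarrow> partial k f y = f' (axis k 1)"
  unfolding partial_def by (metis frechet_derivative_at)

text \<open>Both projections are conformal with the same factor, because the sign \<open>e\<close>
  enters only through its square.\<close>

lemma chart_conformal:
  assumes "e\<^sup>2 = 1"
  shows "partial i (chart e) y \<bullet> partial j (chart e) y
    = (if i = j then 4 / (1 + (y $ 1)\<^sup>2 + (y $ 2)\<^sup>2)\<^sup>2 else 0)"
proof -
  define q where "q = 1 + (y $ 1)\<^sup>2 + (y $ 2)\<^sup>2"
  have "q \<noteq> 0" using sum_squares_pos[of "y $ 1" "y $ 2"] by (simp add: q_def)
  define d where "d v = 2 * y $ 1 * v $ 1 + 2 * y $ 2 * v $ 2" for v :: "real ^ 2"
  have q': "((\<lambda>y. 1 + (y $ 1)\<^sup>2 + (y $ 2)\<^sup>2) has_derivative d) (at y)"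
    by (auto intro!: derivative_eq_intros simp: d_def fun_eq_iff)
  \<comment> \<open>Every coordinate of \<open>chart e\<close> is built from a quotient by
    \<open>q\<close>, so this one rule differentiates all three.\<close>
  have quot: "((\<lambda>y. f y / (1 + (y $ 1)\<^sup>2 + (y $ 2)\<^sup>2)) has_derivative
      (\<lambda>v. (f' v * q - f y * d v) / q\<^sup>2)) (at y)"
    if "(f has_derivative f') (at y)" for f f'
    using has_derivative_divide'[OF that q'] \<open>q \<noteq> 0\<close> by (simp add: q_def power2_eq_square)
  have "(chart e has_derivative (\<lambda>v. ((2 * v $ 1 * q - 2 * y $ 1 * d v) / q\<^sup>2) *\<^sub>R axis 1 1
      + ((2 * v $ 2 * q - 2 * y $ 2 * d v) / q\<^sup>2) *\<^sub>R axis 2 1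
      + (e * (0 - (0 * q - 2 * d v) / q\<^sup>2)) *\<^sub>R axis 3 1)) (at y)"
    unfolding chart_def [abs_def]
    by (intro has_derivative_add has_derivative_scaleR_left has_derivative_mult_right
        has_derivative_diff has_derivative_const quot has_derivative_vec_nth has_derivative_ident)
  note D = partial_eqI[OF this]
  let ?v = "axis i 1 :: real ^ 2" and ?w = "axis j 1 :: real ^ 2"
  have "partial i (chart e) y \<bullet> partial j (chart e) y
      = ((2 * ?v $ 1 * q - 2 * y $ 1 * d ?v) * (2 * ?w $ 1 * q - 2 * y $ 1 * d ?w)
        + (2 * ?v $ 2 * q - 2 * y $ 2 * d ?v) * (2 * ?w $ 2 * q - 2 * y $ 2 * d ?w)
        + e\<^sup>2 * (4 * d ?v * d ?w)) / (q\<^sup>2)\<^sup>2"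
    unfolding D inner_vec_def sum_3
    \<comment> \<open>Only the literal basis vectors of the target are unfolded; \<open>?v\<close>
      and \<open>?w\<close> stay symbolic.\<close>
    by (simp add: axis_def[of 1 "1::real"] axis_def[of 2 "1::real"] axis_def[of 3 "1::real"]
        power2_eq_square add_divide_distrib)
  \<comment> \<open>As \<open>d ?v\<close> is twice the inner product of \<open>y\<close> and
    \<open>?v\<close>, the mixed terms add up to \<open>- 4 * q * d ?v * d ?w\<close>. The remaining
    products of \<open>d ?v\<close> and \<open>d ?w\<close> add up to the opposite, because
    \<open>1 + (y $ 1)\<^sup>2 + (y $ 2)\<^sup>2 = q\<close>.\<close>
  also have "\<dots> = 4 * q\<^sup>2 * (?v $ 1 * ?w $ 1 + ?v $ 2 * ?w $ 2) / (q\<^sup>2)\<^sup>2"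
    unfolding assms d_def q_def by (intro arg_cong2[of _ _ _ _ divide] refl) algebra
  also have "?v $ 1 * ?w $ 1 + ?v $ 2 * ?w $ 2 = (if i = j then 1 else 0)"
    using exhaust_2[of i] exhaust_2[of j] by (auto simp: axis_def)
  finally show ?thesis
    using \<open>q \<noteq> 0\<close> by (simp add: q_def power2_eq_square)
qed

subsection \<open>Curvature\<close>

text \<open>\<open>matrix_inv\<close> is a Hilbert choice; uniqueness of two-sided inverses pins
  down its value.\<close>

lemma matrix_inv_eqI:
  fixes A :: "real ^ 'n ^ 'm"
  assumes "A ** B = mat 1" "B ** A = mat 1"
  shows "matrix_inv A = B"
proof -
  have "A ** matrix_inv A = mat 1 \<and> matrix_inv A ** A = mat 1"
    unfolding matrix_inv_def by (rule someI[of _ B]) (simp add: assms)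
  then have "matrix_inv A = matrix_inv A ** (A ** B)" "matrix_inv A ** A ** B = B"
    by (simp_all add: assms)
  then show ?thesis
    by (simp add: matrix_mul_assoc)
qed

lemma matrix_inv_mat:
  assumes "(c::real) \<noteq> 0"
  shows "matrix_inv (mat c :: real ^ 'n ^ 'n) = mat (1 / c)"
proof (rule matrix_inv_eqI)
  have "(mat a :: real ^ 'n ^ 'n) ** mat b = mat (a * b)" for a b
    by (simp add: matrix_matrix_mult_def mat_def vec_eq_iff if_distrib[of "\<lambda>x. x * _"] cong: if_cong)
  then show "(mat c :: real ^ 'n ^ 'n) ** mat (1 / c) = mat 1"
    "(mat (1 / c) :: real ^ 'n ^ 'n) ** mat c = mat 1"
    using assms by simp_all
qed

lemma partial_const: "partial k (\<lambda>_. c) y = 0"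
  by (rule partial_eqI[THEN trans, OF has_derivative_const]) simp

lemma partial_cmult:
  "(f has_derivative f') (at y) \<Longrightarrow> partial k (\<lambda>y. (c::real) * f y) y = c * f' (axis k 1)"
  by (rule partial_eqI) (rule has_derivative_mult_right)

text \<open>The metric is the round one pulled back by the inverse projection, in the coordinate
  scaled by \<open>1 / b\<close>.\<close>

lemma local_curvature_round:
  fixes b :: real
  assumes "b > 0"
  shows "local_curvature (\<lambda>y. mat (4 * b\<^sup>2 / (b\<^sup>2 + (y $ 1)\<^sup>2 + (y $ 2)\<^sup>2)\<^sup>2)) y = 1"
proof -
  define Q :: "real ^ 2 \<Rightarrow> real" where "Q y = b\<^sup>2 + (y $ 1)\<^sup>2 + (y $ 2)\<^sup>2" for y
  define G :: "real ^ 2 \<Rightarrow> real ^ 2 ^ 2" where "G y = mat (4 * b\<^sup>2 / (Q y)\<^sup>2)" for y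
  have Q: "Q y > 0" for y
    using assms by (simp add: Q_def add_pos_nonneg)
  then have Q0: "Q y \<noteq> 0" for y by (metis less_irrefl)
  have dQ: "(Q has_derivative (\<lambda>v. 2 * y $ 1 * v $ 1 + 2 * y $ 2 * v $ 2)) (at y)" for y
    unfolding Q_def [abs_def] by (auto intro!: derivative_eq_intros simp: fun_eq_iff)
  have inv: "((\<lambda>y. inverse ((Q y)\<^sup>2)) has_derivative
      (\<lambda>v. - 2 * (2 * y $ 1 * v $ 1 + 2 * y $ 2 * v $ 2) / Q y ^ 3)) (at y)" for y
    using Q0[of y] Deriv.has_derivative_inverse[OF _ has_derivative_power[OF dQ, of 2], of y]
    by (rule_tac has_derivative_eq_rhs)
       (auto simp: fun_eq_iff power3_eq_cube power2_eq_square field_simps)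
  have ax: "2 * y $ 1 * axis k 1 $ 1 + 2 * y $ 2 * axis k 1 $ 2 = 2 * y $ k" for k and y :: "real ^ 2"
    using exhaust_2[of k] by (auto simp: axis_def)
  have phi: "partial k (\<lambda>y. 4 * b\<^sup>2 / (Q y)\<^sup>2) y = - 16 * b\<^sup>2 * y $ k / Q y ^ 3" for k y
    using partial_cmult[OF inv, of k "4 * b\<^sup>2" y] unfolding ax divide_inverse
    by (simp only:)
  have dG: "partial k (\<lambda>z. G z $ i $ j) y = (if i = j then - 16 * b\<^sup>2 * y $ k / Q y ^ 3 else 0)" for k i j y
    by (simp add: G_def mat_def phi partial_const)
  have Ginv: "matrix_inv (G y) = mat ((Q y)\<^sup>2 / (4 * b\<^sup>2))" for y
    using assms Q0[of y] by (simp add: G_def matrix_inv_mat)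
  \<comment> \<open>For a metric \<open>exp (2 * f)\<close> times the identity, the symbol is the
    derivative of \<open>f\<close> in direction \<open>i\<close> if \<open>m = j\<close>, plus that
    in direction \<open>j\<close> if \<open>m = i\<close>, minus that in direction \<open>m\<close>
    if \<open>i = j\<close>. Here the derivative of \<open>f\<close> in direction \<open>k\<close>
    is \<open>- 2 * y $ k / Q y\<close>.\<close>
  have Gamma: "christoffel G m i j = (\<lambda>y. - 2 * (((if m = j then y $ i else 0)
      + (if m = i then y $ j else 0) - (if i = j then y $ m else 0)) / Q y))" for m i j
  proof
    fix y
    have "(Q y)\<^sup>2 / (4 * b\<^sup>2) * (if P then - 16 * b\<^sup>2 * r / Q y ^ 3 else 0)
        = - 4 * (if P then r else 0) / Q y" for r P
      using assms Q0[of y] by (simp add: divide_simps power3_eq_cube power2_eq_square)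
    note coeff = this
    have sum: "(\<Sum>l\<in>UNIV. (mat c :: real ^ 2 ^ 2) $ m $ l * E l) = c * E m" for c :: real and E
      by (simp add: mat_def if_distrib[of "\<lambda>x. x * _"] cong: if_cong)
    show "christoffel G m i j y = - 2 * (((if m = j then y $ i else 0)
      + (if m = i then y $ j else 0) - (if i = j then y $ m else 0)) / Q y)"
      unfolding christoffel_def dG Ginv sum unfolding ring_distribs coeff eq_commute[of j m] eq_commute[of i m]
      by (simp add: add_divide_distrib diff_divide_distrib)
  qed
  have dpsi: "((\<lambda>y. y $ i / Q y) has_derivative
      (\<lambda>v. (v $ i * Q y - y $ i * (2 * y $ 1 * v $ 1 + 2 * y $ 2 * v $ 2)) / (Q y)\<^sup>2)) (at y)" for i y
    using has_derivative_divide'[OF has_derivative_vec_nth[OF has_derivative_ident] dQ Q0]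
    by (simp add: power2_eq_square)
  have dpsi': "partial k (\<lambda>y. c * (y $ i / Q y)) y
      = c * ((if i = k then Q y else 0) - 2 * y $ i * y $ k) / (Q y)\<^sup>2" for c k i y
    unfolding partial_cmult[OF dpsi] ax by (simp add: axis_def)
  \<comment> \<open>These six symbols are the ones occurring in \<open>riemann G 1 2 2 1\<close>,
    written in the shape that \<open>dpsi'\<close> differentiates.\<close>
  have *: "christoffel G 1 2 2 = (\<lambda>y. 2 * (y $ 1 / Q y))"
    "christoffel G 2 2 2 = (\<lambda>y. - 2 * (y $ 2 / Q y))"
    "christoffel G 1 1 2 = (\<lambda>y. - 2 * (y $ 2 / Q y))"
    "christoffel G 1 2 1 = (\<lambda>y. - 2 * (y $ 2 / Q y))"
    "christoffel G 2 1 2 = (\<lambda>y. - 2 * (y $ 1 / Q y))"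
    "christoffel G 1 1 1 = (\<lambda>y. - 2 * (y $ 1 / Q y))"
    by (simp_all add: Gamma)
  have "riemann G 1 2 2 1 y = 4 * (Q y - (y $ 1)\<^sup>2 - (y $ 2)\<^sup>2) / (Q y)\<^sup>2"
    unfolding riemann_def sum_2 * dpsi'
    by (simp add: power2_eq_square add_divide_distrib diff_divide_distrib)
  then have "riemann G 1 2 2 1 y = 4 * b\<^sup>2 / (Q y)\<^sup>2"
    by (simp add: Q_def)
  moreover have "det (G y) = (4 * b\<^sup>2 / (Q y)\<^sup>2)\<^sup>2"
    by (simp add: G_def det_2 mat_def power2_eq_square)
  \<comment> \<open>The metric is diagonal, so the component with \<open>l = 2\<close> drops out;
    numerator and determinant are both the square of the conformal factor.\<close>
  moreover have "G y $ 1 $ 1 = 4 * b\<^sup>2 / (Q y)\<^sup>2" "G y $ 1 $ 2 = 0"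
    by (simp_all add: G_def mat_def)
  ultimately have "local_curvature G y = 1"
    unfolding local_curvature_def using assms Q0[of y] by (simp add: sum_2 power2_eq_square)
  then show ?thesis
    by (simp add: G_def [abs_def] Q_def)
qed

subsection \<open>The conformal maps\<close>

text \<open>The argument is the height \<xi> rather than the point, so that differentiation in \<xi>
  is ordinary real differentiation.\<close>

definition denom :: "real \<Rightarrow> real \<Rightarrow> real" where
  "denom a x = (1 + x) + a\<^sup>2 * (1 - x)"

lemma denom_pos:
  assumes "a > 0" "- 1 \<le> x" "x \<le> 1"
  shows "denom a x > 0"
proof (cases "x = 1")
  case False
  then have "0 < a\<^sup>2 * (1 - x)" using assms by simp
  with assms show ?thesis by (simp add: denom_def)
qed (simp add: denom_def)

text \<open>\<open>conf_map a\<close> on the sphere, without the case distinction at the north pole.\<close>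

definition mobius :: "real \<Rightarrow> real ^ 3 \<Rightarrow> real ^ 3" where
  "mobius a p = (1 / denom a (p $ 3)) *\<^sub>R
     ((2 * a) *\<^sub>R p + ((1 - a\<^sup>2) + (1 - a)\<^sup>2 * p $ 3) *\<^sub>R axis 3 1)"

text \<open>The added multiple of \<open>axis 3 1\<close> changes the height only, and
  \<open>2 * a + (1 - a)\<^sup>2 = 1 + a\<^sup>2\<close> gives the third formula.\<close>

lemma mobius_nth:
  "mobius a p $ 1 = 2 * a * p $ 1 / denom a (p $ 3)"
  "mobius a p $ 2 = 2 * a * p $ 2 / denom a (p $ 3)"
  "mobius a p $ 3 = ((1 + p $ 3) - a\<^sup>2 * (1 - p $ 3)) / denom a (p $ 3)"
  by (simp_all add: mobius_def axis_def) (simp add: power2_eq_square algebra_simps)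

text \<open>The closed form also holds at the north pole, so the differential there needs no
  separate treatment.\<close>

lemma conf_map_eq_mobius:
  assumes "p \<in> S2" "a > 0"
  shows "conf_map a p = mobius a p"
proof (cases "p = north")
  case True
  then show ?thesis
    by (simp add: conf_map_def vec_eq_iff forall_3 mobius_nth) (simp add: north_def axis_def denom_def)
next
  case False
  define y where "y = dilation a (stereo p)"
  define D where "D = denom a (p $ 3)"
  have D: "D > 0" using assms sphere3_xi_bounds by (simp add: D_def denom_pos del: mem_sphere_0)
  have nz: "1 - p $ 3 \<noteq> 0" using assms False eq_north_iff by auto
  \<comment> \<open>With \<open>c\<close> as an atom, \<open>field_simps\<close> can cancel the
    nonzero factor \<open>1 - p $ 3\<close>.\<close>
  define c where "c = 1 - p $ 3"
  have c: "p $ 3 = 1 - c" "c \<noteq> 0" using nz by (simp_all add: c_def)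
  have y: "y $ 1 = p $ 1 / (a * (1 - p $ 3))" "y $ 2 = p $ 2 / (a * (1 - p $ 3))"
    by (simp_all add: y_def dilation_def stereo_nth field_simps)
  have "1 + (y $ 1)\<^sup>2 + (y $ 2)\<^sup>2 = 1 + ((p $ 1)\<^sup>2 + (p $ 2)\<^sup>2) / (a * (1 - p $ 3))\<^sup>2"
    by (simp add: y power_divide add_divide_distrib)
  also have "\<dots> = D / (a\<^sup>2 * (1 - p $ 3))"
    unfolding sphere3_horizontal[OF assms(1)] D_def denom_def c(1) using c(2) assms(2)
    by (simp add: field_simps power2_eq_square)
  finally have q: "1 + (y $ 1)\<^sup>2 + (y $ 2)\<^sup>2 = D / (a\<^sup>2 * (1 - p $ 3))" .
  have "chart 1 y $ 1 = mobius a p $ 1" "chart 1 y $ 2 = mobius a p $ 2"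
    unfolding chart_nth q mobius_nth D_def[symmetric]
    using nz D assms by (simp_all add: y field_simps power2_eq_square)
  moreover have "chart 1 y $ 3 = mobius a p $ 3"
    unfolding chart_nth q mobius_nth D_def[symmetric]
    using nz D assms by (simp add: field_simps) (simp add: D_def denom_def algebra_simps)
  ultimately have "chart 1 y = mobius a p" by (simp add: vec_eq_iff forall_3)
  then show ?thesis
    using False by (simp add: conf_map_def stereo_inv_eq y_def)
qed

section \<open>Differentials on the sphere and the pullback metric\<close>

lemma sgn_line_in_sphere:
  assumes "p \<in> S2" "v \<in> tangent_space p"
  shows "sgn (p + s *\<^sub>R v) \<in> S2"
proof -
  \<comment> \<open>A tangent displacement keeps the component along \<open>p\<close> equal to 1, so
    the line misses the origin and \<open>sgn\<close> normalises it.\<close>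
  have "(p + s *\<^sub>R v) \<bullet> p = 1"
    using assms by (simp add: tangent_space_def inner_add_left dot_square_norm)
  then have "p + s *\<^sub>R v \<noteq> 0" by auto
  then show ?thesis by (simp add: norm_sgn)
qed

text \<open>By Pythagoras the norm is even in \<open>s\<close>, so normalising changes nothing to
  first order.\<close>

lemma sgn_line_has_vector_derivative:
  assumes "p \<in> S2" "v \<in> tangent_space p"
  shows "((\<lambda>s. sgn (p + s *\<^sub>R v)) has_vector_derivative v) (at 0)"
proof -
  have "norm (p + s *\<^sub>R v) = sqrt (1 + s\<^sup>2 * (v \<bullet> v))" for s
    using assms
    by (simp add: norm_eq_sqrt_inner tangent_space_def inner_add_left inner_add_right
        inner_commute[of p v] power2_eq_square)
  then have eq: "(\<lambda>s. sgn (p + s *\<^sub>R v)) = (\<lambda>s. inverse (sqrt (1 + s\<^sup>2 * (v \<bullet> v))) *\<^sub>R (p + s *\<^sub>R v))"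
    by (simp add: sgn_div_norm)
  show ?thesis
    unfolding eq by (auto intro!: derivative_eq_intros)
qed

text \<open>\<open>differential\<close> follows a curve inside \<open>S2\<close>, so a function may
  be replaced by any formula agreeing with it there.\<close>

lemma differential_eqI:
  assumes "p \<in> S2" "v \<in> tangent_space p" "\<And>q. q \<in> S2 \<Longrightarrow> f q = h q"
    and "((\<lambda>s. h (sgn (p + s *\<^sub>R v))) has_vector_derivative d) (at 0)"
  shows "differential f p v = d"
proof -
  have "(\<lambda>s. f (sgn (p + s *\<^sub>R v))) = (\<lambda>s. h (sgn (p + s *\<^sub>R v)))"
    using assms sgn_line_in_sphere by blast
  then show ?thesis
    unfolding differential_def using assms(4) by (simp add: vector_derivative_at)
qed

text \<open>This is the product rule for \<open>mobius a\<close>; the subtracted term comes from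
  differentiating \<open>1 / denom a\<close>.\<close>

lemma differential_conf_map:
  assumes "p \<in> S2" "v \<in> tangent_space p" "a > 0"
  defines "D \<equiv> denom a (p $ 3)"
  shows "differential (conf_map a) p v = (1 / D) *\<^sub>R ((2 * a) *\<^sub>R v + ((1 - a)\<^sup>2 * v $ 3) *\<^sub>R axis 3 1)
    - ((1 - a\<^sup>2) * v $ 3 / D\<^sup>2) *\<^sub>R
      ((2 * a) *\<^sub>R p + ((1 - a\<^sup>2) + (1 - a)\<^sup>2 * p $ 3) *\<^sub>R axis 3 1)"
proof (rule differential_eqI[OF assms(1,2), of _ "mobius a"])
  let ?c = "\<lambda>s. sgn (p + s *\<^sub>R v)"
  have D: "D \<noteq> 0" using assms sphere3_xi_bounds[of p] denom_pos[of a "p $ 3"] by auto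
  have c: "(?c has_vector_derivative v) (at 0)"
    by (rule sgn_line_has_vector_derivative[OF assms(1,2)])
  have c0: "?c 0 = p" "sgn p = p" using assms(1) by (simp_all add: sgn_div_norm)
  have c3: "((\<lambda>s. ?c s $ 3) has_field_derivative v $ 3) (at 0)"
    using has_vector_derivative_vec_nth[OF c] by (simp add: has_real_derivative_iff_has_vector_derivative)
  have d: "((\<lambda>s. denom a (?c s $ 3)) has_field_derivative (1 - a\<^sup>2) * v $ 3) (at 0)"
    unfolding denom_def by (auto intro!: derivative_eq_intros c3 simp: algebra_simps)
  have r: "((\<lambda>s. 1 / denom a (?c s $ 3)) has_field_derivative - ((1 - a\<^sup>2) * v $ 3 / D\<^sup>2)) (at 0)"
    using DERIV_inverse'[OF d] D
    by (simp add: c0 divide_inverse power2_eq_square ac_simps flip: D_def)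
  have w: "((\<lambda>s. (2 * a) *\<^sub>R ?c s + ((1 - a\<^sup>2) + (1 - a)\<^sup>2 * ?c s $ 3) *\<^sub>R axis 3 1)
      has_vector_derivative (2 * a) *\<^sub>R v + ((1 - a)\<^sup>2 * v $ 3) *\<^sub>R axis 3 1) (at 0)"
    by (auto intro!: derivative_eq_intros c c3)
  show "((\<lambda>s. mobius a (?c s)) has_vector_derivative (1 / D) *\<^sub>R ((2 * a) *\<^sub>R v + ((1 - a)\<^sup>2 * v $ 3) *\<^sub>R axis 3 1)
    - ((1 - a\<^sup>2) * v $ 3 / D\<^sup>2) *\<^sub>R
      ((2 * a) *\<^sub>R p + ((1 - a\<^sup>2) + (1 - a)\<^sup>2 * p $ 3) *\<^sub>R axis 3 1)) (at 0)"
    unfolding mobius_def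
    using has_vector_derivative_scaleR[OF r w] by (simp add: c0 D_def)
qed (use assms conf_map_eq_mobius in auto)

lemma pullback_conf_map:
  assumes "a > 0"
  shows "metric_eq (pullback (conf_map a) g0)
    (scale_metric (\<lambda>p. (2 * a / ((1 + xi p) + a\<^sup>2 * (1 - xi p)))\<^sup>2) g0)"
  unfolding metric_eq_def
proof (intro ballI)
  fix p v w
  assume p: "p \<in> S2" and v: "v \<in> tangent_space p" and w: "w \<in> tangent_space p"
  define D where "D = denom a (p $ 3)"
  define F where "F v = (1 / D) *\<^sub>R ((2 * a) *\<^sub>R v + ((1 - a)\<^sup>2 * v $ 3) *\<^sub>R axis 3 1)
    - ((1 - a\<^sup>2) * v $ 3 / D\<^sup>2) *\<^sub>R
      ((2 * a) *\<^sub>R p + ((1 - a\<^sup>2) + (1 - a)\<^sup>2 * p $ 3) *\<^sub>R axis 3 1)" for v :: "real ^ 3"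
  have D: "D \<noteq> 0" using p assms sphere3_xi_bounds[of p] denom_pos[of a "p $ 3"] by (auto simp: D_def)
  have "x / D - c / D\<^sup>2 * y = (x * D - c * y) / D\<^sup>2" for x c y
    using D by (simp add: diff_divide_distrib power2_eq_square)
  note quot = this
  have F: "F v $ 1 = 2 * a * (v $ 1 * D - (1 - a\<^sup>2) * v $ 3 * p $ 1) / D\<^sup>2"
    "F v $ 2 = 2 * a * (v $ 2 * D - (1 - a\<^sup>2) * v $ 3 * p $ 2) / D\<^sup>2" for v
    using quot[of "2 * a * v $ 1"] quot[of "2 * a * v $ 2"]
    by (simp_all add: F_def axis_def) (simp_all add: algebra_simps)
  have F3: "F v $ 3 = 4 * a\<^sup>2 * v $ 3 / D\<^sup>2" for v
  proof -
    have "F v $ 3 = (2 * a * v $ 3 + (1 - a)\<^sup>2 * v $ 3) / D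
        - (1 - a\<^sup>2) * v $ 3 / D\<^sup>2 * (2 * a * p $ 3 + (1 - a\<^sup>2 + (1 - a)\<^sup>2 * p $ 3))"
      by (simp add: F_def axis_def)
    also have "\<dots> = 4 * a\<^sup>2 * v $ 3 / D\<^sup>2"
      unfolding quot
      by (rule arg_cong[of _ _ "\<lambda>x. x / D\<^sup>2"])
         (simp add: D_def denom_def algebra_simps power2_eq_square)
    finally show ?thesis .
  qed
  \<comment> \<open>Tangency trades the horizontal part of the inner product with \<open>p\<close>
    for the vertical part.\<close>
  have vp: "v $ 1 * p $ 1 + v $ 2 * p $ 2 = - v $ 3 * p $ 3"
    and wp: "w $ 1 * p $ 1 + w $ 2 * p $ 2 = - w $ 3 * p $ 3"
    using v w by (simp_all add: tangent_space_def inner_vec_def sum_3)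
  have "F v \<bullet> F w = (4 * a\<^sup>2 * ((v $ 1 * D - (1 - a\<^sup>2) * v $ 3 * p $ 1) * (w $ 1 * D - (1 - a\<^sup>2) * w $ 3 * p $ 1)
      + (v $ 2 * D - (1 - a\<^sup>2) * v $ 3 * p $ 2) * (w $ 2 * D - (1 - a\<^sup>2) * w $ 3 * p $ 2)
      + 4 * a\<^sup>2 * v $ 3 * w $ 3)) / (D\<^sup>2)\<^sup>2"
  proof -
    have "2 * a * x / E * (2 * a * y / E) + 2 * a * x' / E * (2 * a * y' / E)
        + 4 * a\<^sup>2 * r / E * (4 * a\<^sup>2 * s / E)
        = 4 * a\<^sup>2 * (x * y + x' * y' + 4 * a\<^sup>2 * r * s) / E\<^sup>2" for x y x' y' r s E
      by (simp add: power2_eq_square add_divide_distrib algebra_simps)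
    then show ?thesis
      unfolding inner_vec_def sum_3 F F3 inner_real_def .
  qed
  also have "(v $ 1 * D - (1 - a\<^sup>2) * v $ 3 * p $ 1) * (w $ 1 * D - (1 - a\<^sup>2) * w $ 3 * p $ 1)
      + (v $ 2 * D - (1 - a\<^sup>2) * v $ 3 * p $ 2) * (w $ 2 * D - (1 - a\<^sup>2) * w $ 3 * p $ 2)
      + 4 * a\<^sup>2 * v $ 3 * w $ 3 = D\<^sup>2 * (v $ 1 * w $ 1 + v $ 2 * w $ 2 + v $ 3 * w $ 3)" (is "?lhs = _")
  proof -
    have "?lhs = D\<^sup>2 * (v $ 1 * w $ 1 + v $ 2 * w $ 2)
        - D * (1 - a\<^sup>2) * (w $ 3 * (v $ 1 * p $ 1 + v $ 2 * p $ 2) + v $ 3 * (w $ 1 * p $ 1 + w $ 2 * p $ 2))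
        + v $ 3 * w $ 3 * ((1 - a\<^sup>2)\<^sup>2 * ((p $ 1)\<^sup>2 + (p $ 2)\<^sup>2) + 4 * a\<^sup>2)"
      by (simp add: algebra_simps power2_eq_square)
    also have "\<dots> = D\<^sup>2 * (v $ 1 * w $ 1 + v $ 2 * w $ 2)
        + v $ 3 * w $ 3 * (2 * D * (1 - a\<^sup>2) * p $ 3 + (1 - a\<^sup>2)\<^sup>2 * ((1 - p $ 3) * (1 + p $ 3)) + 4 * a\<^sup>2)"
      unfolding vp wp sphere3_horizontal[OF p] by (simp add: algebra_simps)
    \<comment> \<open>Since \<open>D = (1 + a\<^sup>2) + (1 - a\<^sup>2) * p $ 3\<close>, this is a
      completed square, using \<open>(1 - a\<^sup>2)\<^sup>2 + 4 * a\<^sup>2 = (1 +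
      a\<^sup>2)\<^sup>2\<close>.\<close>
    also have "2 * D * (1 - a\<^sup>2) * p $ 3 + (1 - a\<^sup>2)\<^sup>2 * ((1 - p $ 3) * (1 + p $ 3)) + 4 * a\<^sup>2 = D\<^sup>2"
      by (simp add: D_def denom_def algebra_simps power2_eq_square)
    finally show ?thesis by (simp add: algebra_simps)
  qed
  also have "4 * a\<^sup>2 * (D\<^sup>2 * (v $ 1 * w $ 1 + v $ 2 * w $ 2 + v $ 3 * w $ 3)) / (D\<^sup>2)\<^sup>2
      = (2 * a / D)\<^sup>2 * (v \<bullet> w)"
    using D by (simp add: inner_vec_def sum_3 power2_eq_square)
  finally have "F v \<bullet> F w = (2 * a / D)\<^sup>2 * (v \<bullet> w)" .
  then show "pullback (conf_map a) g0 p v w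
      = scale_metric (\<lambda>p. (2 * a / ((1 + xi p) + a\<^sup>2 * (1 - xi p)))\<^sup>2) g0 p v w"
    using differential_conf_map[OF p _ assms] v w
    by (simp add: pullback_def g0_def scale_metric_def xi_def F_def D_def denom_def)
qed

text \<open>Evaluating both metrics on a single nonzero tangent vector already determines the
  factor.\<close>

lemma conf_factor_unique:
  assumes "metric_eq (conf_metric u) (scale_metric f g0)" "p \<in> S2"
  shows "exp (2 * u p) = f p"
proof -
  have "\<exists>v. v \<in> tangent_space p \<and> v \<noteq> 0"
  \<comment> \<open>The horizontal rotation field used in the second case vanishes at the poles,
    hence the split.\<close>
  proof (cases "p $ 1 = 0")
    case True
    then show ?thesis
      by (intro exI[of _ "axis 1 1"]) (simp add: tangent_space_def inner_axis' axis_eq_0_iff)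
  next
    case False
    then show ?thesis
      by (intro exI[of _ "vector [- (p $ 2), p $ 1, 0]"])
        (auto simp: tangent_space_def inner_vec_def sum_3 vec_eq_iff forall_3)
  qed
  then obtain v where "v \<in> tangent_space p" "v \<noteq> 0" by blast
  with assms have "conf_metric u p v v = scale_metric f g0 p v v"
    by (simp add: metric_eq_def)
  with \<open>v \<noteq> 0\<close> show ?thesis
    by (simp add: conf_metric_def scale_metric_def g0_def)
qed

subsection \<open>The path\<close>

text \<open>Off the sphere a solution \<open>u\<close> is unconstrained; the lemmas on its
  smoothness, curvature and geodesic equation therefore assume agreement with this formula on
  \<open>S2\<close> only.\<close>

definition conf_path :: "real \<Rightarrow> real \<Rightarrow> real ^ 3 \<Rightarrow> real" where
  "conf_path lam t p = ln 2 + lam * t - ln (denom (exp (lam * t)) (p $ 3))"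

lemma denom_exp_pos: "p \<in> S2 \<Longrightarrow> denom (exp t) (p $ 3) > 0"
  using sphere3_xi_bounds[of p] by (auto intro: denom_pos)

lemma exp_conf_path:
  assumes "p \<in> S2"
  shows "exp (2 * conf_path lam t p) = (2 * exp (lam * t) / denom (exp (lam * t)) (p $ 3))\<^sup>2"
proof -
  have "exp (conf_path lam t p) = 2 * exp (lam * t) / denom (exp (lam * t)) (p $ 3)"
    using denom_exp_pos[OF assms] by (simp add: conf_path_def exp_diff exp_add)
  then show ?thesis by (simp add: exp_double)
qed

text \<open>The denominator \<open>1 + (y $ 1)\<^sup>2 + (y $ 2)\<^sup>2\<close> is displayed
  because it later cancels against the round metric of the chart.\<close>

lemma denom_chart:
  "denom a (chart 1 y $ 3) = 2 * (a\<^sup>2 + (y $ 1)\<^sup>2 + (y $ 2)\<^sup>2) / (1 + (y $ 1)\<^sup>2 + (y $ 2)\<^sup>2)"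
  "denom a (chart (- 1) y $ 3)
    = 2 * (1 + a\<^sup>2 * ((y $ 1)\<^sup>2 + (y $ 2)\<^sup>2)) / (1 + (y $ 1)\<^sup>2 + (y $ 2)\<^sup>2)"
proof -
  define q where "q = 1 + (y $ 1)\<^sup>2 + (y $ 2)\<^sup>2"
  have q: "q \<noteq> 0" using sum_squares_pos[of "y $ 1" "y $ 2"] by (simp add: q_def)
  have r: "(y $ 2)\<^sup>2 = q - 1 - (y $ 1)\<^sup>2" by (simp add: q_def)
  show "denom a (chart 1 y $ 3) = 2 * (a\<^sup>2 + (y $ 1)\<^sup>2 + (y $ 2)\<^sup>2) / (1 + (y $ 1)\<^sup>2 + (y $ 2)\<^sup>2)"
    unfolding denom_def chart_nth r using q by (simp add: field_simps)
  show "denom a (chart (- 1) y $ 3)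
    = 2 * (1 + a\<^sup>2 * ((y $ 1)\<^sup>2 + (y $ 2)\<^sup>2)) / (1 + (y $ 1)\<^sup>2 + (y $ 2)\<^sup>2)"
    unfolding denom_def chart_nth r using q by (simp add: field_simps)
qed

text \<open>Squares are written as products to match the rules of \<open>elementary\<close>, and the
  arguments of all logarithms are positive on the whole plane.\<close>

lemma conf_path_chart:
  "conf_path lam t (chart 1 y) = lam * t + ln (1 + y $ 1 * y $ 1 + y $ 2 * y $ 2)
    - ln (exp (lam * t) * exp (lam * t) + y $ 1 * y $ 1 + y $ 2 * y $ 2)"
  "conf_path lam t (chart (- 1) y) = lam * t + ln (1 + y $ 1 * y $ 1 + y $ 2 * y $ 2)
    - ln (1 + exp (lam * t) * exp (lam * t) * (y $ 1 * y $ 1 + y $ 2 * y $ 2))"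
proof -
  have ln: "ln (2 * m / q) = ln 2 + ln m - ln q" if "m > 0" "q > 0" for m q :: real
    using that by (simp add: ln_div ln_mult)
  show "conf_path lam t (chart 1 y) = lam * t + ln (1 + y $ 1 * y $ 1 + y $ 2 * y $ 2)
    - ln (exp (lam * t) * exp (lam * t) + y $ 1 * y $ 1 + y $ 2 * y $ 2)"
    unfolding conf_path_def denom_chart
    by (subst ln) (simp_all add: add_pos_nonneg power2_eq_square)
  show "conf_path lam t (chart (- 1) y) = lam * t + ln (1 + y $ 1 * y $ 1 + y $ 2 * y $ 2)
    - ln (1 + exp (lam * t) * exp (lam * t) * (y $ 1 * y $ 1 + y $ 2 * y $ 2))"
    unfolding conf_path_def denom_chart
    by (subst ln) (simp_all add: add_pos_nonneg power2_eq_square)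
qed

text \<open>A variable \<tau> covers both uses: constant for smoothness at a fixed time, and
  \<open>snd\<close> for joint smoothness.\<close>

lemma elementary_conf_path:
  assumes "elementary f" "elementary g" "elementary \<tau>"
  shows "elementary (\<lambda>z. lam * \<tau> z + ln (1 + f z * f z + g z * g z)
      - ln (exp (lam * \<tau> z) * exp (lam * \<tau> z) + f z * f z + g z * g z))"
    "elementary (\<lambda>z. lam * \<tau> z + ln (1 + f z * f z + g z * g z)
      - ln (1 + exp (lam * \<tau> z) * exp (lam * \<tau> z) * (f z * f z + g z * g z)))"
  by (intro elementary_diff elementary.add elementary.mult elementary.ln elementary.exp
      elementary.const assms; simp add: add_pos_nonneg)+

lemma smooth_conf_path:
  assumes "\<And>t p. p \<in> S2 \<Longrightarrow> u t p = conf_path lam t p"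
  shows "smooth_S2 (u t)"
    "smooth (\<lambda>(y, t). u t (stereo_inv y))" "smooth (\<lambda>(y, t). u t (stereo_inv_south y))"
proof -
  have chart: "u t (chart 1 y) = conf_path lam t (chart 1 y)"
    "u t (chart (- 1) y) = conf_path lam t (chart (- 1) y)" for t y
    using chart_in_sphere by (auto intro!: assms simp del: mem_sphere_0)
  have nth: "elementary (\<lambda>y :: real ^ 2. y $ i)" for i
    by (intro elementary.linear bounded_linear_vec_nth)
  show "smooth_S2 (u t)"
    unfolding smooth_S2_def comp_def stereo_inv_eq stereo_inv_south_eq chart conf_path_chart
    by (intro conjI elementary_smooth elementary_conf_path nth elementary.const)
  have fst: "elementary (\<lambda>z :: (real ^ 2) \<times> real. fst z $ i)" for i
    by (intro elementary.linear bounded_linear_compose[OF bounded_linear_vec_nth] bounded_linear_fst)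
  have snd: "elementary (snd :: (real ^ 2) \<times> real \<Rightarrow> real)"
    by (intro elementary.linear bounded_linear_snd)
  show "smooth (\<lambda>(y, t). u t (stereo_inv y))" "smooth (\<lambda>(y, t). u t (stereo_inv_south y))"
    unfolding case_prod_beta stereo_inv_eq stereo_inv_south_eq chart conf_path_chart
    by (intro elementary_smooth elementary_conf_path fst snd)+
qed

lemma local_metric_chart:
  assumes "e\<^sup>2 = 1"
  shows "local_metric (conf_metric u) (chart e)
    = (\<lambda>y. mat (exp (2 * u (chart e y)) * (4 / (1 + (y $ 1)\<^sup>2 + (y $ 2)\<^sup>2)\<^sup>2)))"
  by (simp add: local_metric_def conf_metric_def scale_metric_def g0_def chart_conformal[OF assms]
      mat_def fun_eq_iff vec_eq_iff)

lemma gauss_curvature_conf_path: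
  assumes u: "\<And>p. p \<in> S2 \<Longrightarrow> u p = conf_path lam t p"
  shows "gauss_curvature (conf_metric u) p = 1"
proof -
  define a where "a = exp (lam * t)"
  have a: "a > 0" by (simp add: a_def)
  have exp_u: "exp (2 * u (chart e y)) = (2 * a / denom a (chart e y $ 3))\<^sup>2" if "e\<^sup>2 = 1" for e y
    using exp_conf_path[OF chart_in_sphere[OF that]] u[OF chart_in_sphere[OF that]] by (simp add: a_def)
  \<comment> \<open>Here \<open>q\<close> is the denominator from \<open>denom_chart\<close>; it
    cancels against the round metric and leaves the model of
    \<open>local_curvature_round\<close>.\<close>
  have factor: "(2 * a / (2 * m / q))\<^sup>2 * (4 / q\<^sup>2) = 4 * a\<^sup>2 / m\<^sup>2" if "q \<noteq> 0" for m q
    using that by (simp add: power2_eq_square)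
  have "local_metric (conf_metric u) (chart 1)
      = (\<lambda>y. mat (4 * a\<^sup>2 / (a\<^sup>2 + (y $ 1)\<^sup>2 + (y $ 2)\<^sup>2)\<^sup>2))"
  proof
    fix y :: "real ^ 2"
    have "1 + (y $ 1)\<^sup>2 + (y $ 2)\<^sup>2 \<noteq> 0" using sum_squares_pos[of "y $ 1" "y $ 2"] by simp
    then show "local_metric (conf_metric u) (chart 1) y
        = mat (4 * a\<^sup>2 / (a\<^sup>2 + (y $ 1)\<^sup>2 + (y $ 2)\<^sup>2)\<^sup>2)"
      by (simp only: local_metric_chart exp_u denom_chart factor one_power2 power2_minus not_False_eq_True)
  qed
  moreover have "local_metric (conf_metric u) (chart (- 1))
      = (\<lambda>y. mat (4 * (1 / a)\<^sup>2 / ((1 / a)\<^sup>2 + (y $ 1)\<^sup>2 + (y $ 2)\<^sup>2)\<^sup>2))"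
  proof
    fix y :: "real ^ 2"
    have "1 + (y $ 1)\<^sup>2 + (y $ 2)\<^sup>2 \<noteq> 0" using sum_squares_pos[of "y $ 1" "y $ 2"] by simp
    then have "local_metric (conf_metric u) (chart (- 1)) y
        = mat (4 * a\<^sup>2 / (1 + a\<^sup>2 * ((y $ 1)\<^sup>2 + (y $ 2)\<^sup>2))\<^sup>2)"
      by (simp only: local_metric_chart exp_u denom_chart factor one_power2 power2_minus not_False_eq_True)
    \<comment> \<open>Extracting \<open>a\<^sup>2\<close> exhibits the model metric with
      \<open>b = 1 / a\<close>.\<close>
    also have "1 + a\<^sup>2 * ((y $ 1)\<^sup>2 + (y $ 2)\<^sup>2) = a\<^sup>2 * ((1 / a)\<^sup>2 + (y $ 1)\<^sup>2 + (y $ 2)\<^sup>2)"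
      using a by (simp add: ring_distribs power_divide)
    also have "4 * a\<^sup>2 / (a\<^sup>2 * r)\<^sup>2 = 4 * (1 / a)\<^sup>2 / r\<^sup>2" for r
      using a by (simp add: power2_eq_square)
    finally show "local_metric (conf_metric u) (chart (- 1)) y
        = mat (4 * (1 / a)\<^sup>2 / ((1 / a)\<^sup>2 + (y $ 1)\<^sup>2 + (y $ 2)\<^sup>2)\<^sup>2)" .
  qed
  ultimately show ?thesis
    using a by (simp add: gauss_curvature_def stereo_inv_eq stereo_inv_south_eq
        local_curvature_round)
qed

section \<open>Functions of the height and the geodesic equation\<close>

lemma differential_zonal:
  assumes "p \<in> S2" "v \<in> tangent_space p" "\<And>q. q \<in> S2 \<Longrightarrow> f q = h (q $ 3)"
    and "(h has_real_derivative k) (at (p $ 3))"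
  shows "differential f p v = k * v $ 3"
proof (rule differential_eqI[OF assms(1,2,3)])
  have "((\<lambda>s. sgn (p + s *\<^sub>R v) $ 3) has_real_derivative v $ 3) (at 0)"
    using has_vector_derivative_vec_nth[OF sgn_line_has_vector_derivative[OF assms(1,2)]]
    by (simp add: has_real_derivative_iff_has_vector_derivative)
  moreover have "sgn p = p" using assms(1) by (simp add: sgn_div_norm)
  ultimately have "((\<lambda>s. h (sgn (p + s *\<^sub>R v) $ 3)) has_real_derivative k * v $ 3) (at 0)"
    using assms(4) by (intro DERIV_chain2[of h]) simp_all
  then show "((\<lambda>s. h (sgn (p + s *\<^sub>R v) $ 3)) has_vector_derivative k * v $ 3) (at 0)"
    by (simp add: has_real_derivative_iff_has_vector_derivative)
qed

lemma norm_gradient_zonal: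
  fixes u f :: "real ^ 3 \<Rightarrow> real"
  assumes "p \<in> S2" and f: "\<And>v. v \<in> tangent_space p \<Longrightarrow> differential f p v = k * v $ 3"
  defines "X \<equiv> gradient (conf_metric u) f p"
  shows "conf_metric u p X X = k\<^sup>2 * (1 - (p $ 3)\<^sup>2) / exp (2 * u p)"
proof -
  define E where "E = exp (2 * u p)"
  have E: "E \<noteq> 0" by (simp add: E_def)
  \<comment> \<open>\<open>Y\<close> is the tangential projection of the third basis vector times
    \<open>k\<close>, divided by \<open>E\<close> because the conformal metric multiplies inner
    products by \<open>E\<close>.\<close>
  define Y where "Y = (k / E) *\<^sub>R (axis 3 1 - (p $ 3) *\<^sub>R p)"
  have pp: "p \<bullet> p = 1" using assms(1) by (simp add: dot_square_norm)
  have e3: "axis 3 1 \<bullet> v = v $ 3" "v \<bullet> axis 3 1 = v $ 3" for v :: "real ^ 3"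
    by (simp_all add: inner_axis inner_axis')
  have tangent: "Y \<in> tangent_space p"
    by (simp add: Y_def tangent_space_def inner_diff_left e3 pp)
  have dual: "E * (Y \<bullet> w) = k * w $ 3" if "w \<in> tangent_space p" for w
    using that E by (simp add: Y_def tangent_space_def inner_diff_left e3 inner_commute[of p w])
  have "X = Y"
    unfolding X_def gradient_def
  proof (rule the_equality)
    show "Y \<in> tangent_space p \<and> (\<forall>w\<in>tangent_space p. conf_metric u p Y w = differential f p w)"
      using tangent dual f by (simp add: conf_metric_def scale_metric_def g0_def E_def)
  next
    fix Z
    assume Z: "Z \<in> tangent_space p \<and> (\<forall>w\<in>tangent_space p. conf_metric u p Z w = differential f p w)"
    \<comment> \<open>Testing both candidates against their own difference forces that difference to
      vanish.\<close>
    then have "Z - Y \<in> tangent_space p"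
      using tangent by (simp add: tangent_space_def inner_diff_left)
    moreover from this have "E * (Z \<bullet> (Z - Y)) = E * (Y \<bullet> (Z - Y))"
      using Z dual f by (simp add: conf_metric_def scale_metric_def g0_def E_def)
    ultimately have "(Z - Y) \<bullet> (Z - Y) = 0"
      using E by (simp add: inner_diff_left)
    then show "Z = Y" by simp
  qed
  moreover have "conf_metric u p Y Y = k * Y $ 3"
    using dual[OF tangent] by (simp add: conf_metric_def scale_metric_def g0_def E_def)
  moreover have "Y $ 3 = k / E * (1 - (p $ 3)\<^sup>2)"
    by (simp add: Y_def axis_def power2_eq_square)
  ultimately show ?thesis
    by (simp add: E_def power2_eq_square)
qed

lemma conf_path_geodesic:
  assumes u: "\<And>t p. p \<in> S2 \<Longrightarrow> u t p = conf_path lam t p"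
  shows "geodesic_Gamma1_plus u"
proof -
  define N where "N t x = (1 + x) - (exp (lam * t))\<^sup>2 * (1 - x)" for t x
  define D where "D t x = denom (exp (lam * t)) x" for t x
  have D: "D t (p $ 3) > 0" if "p \<in> S2" for t p
    using denom_exp_pos[OF that] by (simp add: D_def)
  have D_t: "((\<lambda>t. D t x) has_real_derivative 2 * lam * (exp (lam * t))\<^sup>2 * (1 - x)) (at t)" for t x
    unfolding D_def denom_def
    by (auto intro!: derivative_eq_intros simp: power2_eq_square)
  have N_t: "((\<lambda>t. N t x) has_real_derivative - 2 * lam * (exp (lam * t))\<^sup>2 * (1 - x)) (at t)" for t x
    unfolding N_def
    by (auto intro!: derivative_eq_intros simp: power2_eq_square)
  have D_x: "((\<lambda>x. D t x) has_real_derivative 1 - (exp (lam * t))\<^sup>2) (at x)" for t x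
    unfolding D_def denom_def by (auto intro!: derivative_eq_intros)
  have N_x: "((\<lambda>x. N t x) has_real_derivative 1 + (exp (lam * t))\<^sup>2) (at x)" for t x
    unfolding N_def by (auto intro!: derivative_eq_intros)
  have u_t: "time_deriv u t p = lam * (N t (p $ 3) / D t (p $ 3))" if "p \<in> S2" for t p
  proof -
    have "((\<lambda>t. ln 2 + lam * t - ln (D t (p $ 3))) has_real_derivative
        lam - 2 * lam * (exp (lam * t))\<^sup>2 * (1 - p $ 3) / D t (p $ 3)) (at t)"
      using D[OF that] by (auto intro!: derivative_eq_intros D_t)
    \<comment> \<open>This rests on \<open>N = D - 2 * a\<^sup>2 * (1 - x)\<close>, where
      \<open>a = exp (lam * t)\<close> and \<open>x = p $ 3\<close>.\<close>
    also have "lam - 2 * lam * (exp (lam * t))\<^sup>2 * (1 - p $ 3) / D t (p $ 3) = lam * (N t (p $ 3) / D t (p $ 3))"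
      using D[OF that, of t] by (simp add: field_simps) (simp add: N_def D_def denom_def algebra_simps)
    finally show ?thesis
      using u[OF that] by (simp add: time_deriv_def conf_path_def D_def DERIV_imp_deriv)
  qed
  \<comment> \<open>The curvature factor is left out here; \<open>K\<close> below shows that it
    equals 1.\<close>
  have geodesic: "time_deriv (time_deriv u) t p + conf_metric (u t) p X X = 0"
    if p: "p \<in> S2" and X: "X = gradient (conf_metric (u t)) (time_deriv u t) p" for t p X
  proof -
    define x where "x = p $ 3"
    define a where "a = exp (lam * t)"
    have "a > 0" by (simp add: a_def)
    have D0: "D t x > 0" using D[OF p] by (simp add: x_def)
    have "((\<lambda>t. lam * (N t x / D t x)) has_real_derivative
        lam * ((- 2 * lam * a\<^sup>2 * (1 - x) * D t x - N t x * (2 * lam * a\<^sup>2 * (1 - x))) / (D t x * D t x))) (at t)"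
      using D0 unfolding a_def by (intro DERIV_cmult DERIV_divide N_t D_t) simp
    \<comment> \<open>The common factor multiplies \<open>D + N = 2 * (1 + x)\<close>.\<close>
    also have "- 2 * lam * a\<^sup>2 * (1 - x) * D t x - N t x * (2 * lam * a\<^sup>2 * (1 - x)) = - 4 * lam * a\<^sup>2 * (1 - x\<^sup>2)"
      by (simp add: N_def D_def denom_def a_def algebra_simps power2_eq_square)
    finally have tt: "time_deriv (time_deriv u) t p = lam * (- 4 * lam * a\<^sup>2 * (1 - x\<^sup>2) / (D t x * D t x))"
      using u_t[OF p] unfolding time_deriv_def[of "time_deriv u"] by (simp add: DERIV_imp_deriv x_def)
    have "((\<lambda>x. lam * (N t x / D t x)) has_real_derivative
        lam * (((1 + a\<^sup>2) * D t x - N t x * (1 - a\<^sup>2)) / (D t x * D t x))) (at x)"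
      using D0 unfolding a_def by (intro DERIV_cmult DERIV_divide N_x D_x) simp
    \<comment> \<open>The terms in \<open>x\<close> cancel and leave
      \<open>(1 + a\<^sup>2)\<^sup>2 - (1 - a\<^sup>2)\<^sup>2\<close>.\<close>
    also have "(1 + a\<^sup>2) * D t x - N t x * (1 - a\<^sup>2) = 4 * a\<^sup>2"
      by (simp add: N_def D_def denom_def a_def algebra_simps power2_eq_square)
    finally have "differential (time_deriv u t) p v = lam * (4 * a\<^sup>2 / (D t x * D t x)) * v $ 3"
      if "v \<in> tangent_space p" for v
      using p that u_t by (intro differential_zonal[of p v _ "\<lambda>x. lam * (N t x / D t x)"]) (auto simp: x_def)
    from norm_gradient_zonal[OF p this, of "u t"]
    have "conf_metric (u t) p X X
        = (lam * (4 * a\<^sup>2 / (D t x * D t x)))\<^sup>2 * (1 - x\<^sup>2) / (2 * a / D t x)\<^sup>2"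
      unfolding X by (simp add: u[OF p] exp_conf_path[OF p] x_def a_def D_def)
    also have "\<dots> = 4 * lam\<^sup>2 * a\<^sup>2 * (1 - x\<^sup>2) / (D t x * D t x)"
      using D0 \<open>a > 0\<close> by (simp add: power2_eq_square)
    finally show ?thesis
      unfolding tt by (simp add: power2_eq_square)
  qed
  have K: "gauss_curvature (conf_metric (u t)) p = 1" for t p
    by (rule gauss_curvature_conf_path[OF u])
  show ?thesis
    unfolding geodesic_Gamma1_plus_def path_in_Gamma1_plus_def Gamma1_plus_def Let_def
    using smooth_conf_path[OF u] geodesic by (auto simp: K)
qed

theorem proposition3p5:
  fixes lam :: real and \<alpha> :: "real \<Rightarrow> real"
  assumes "\<And>t. \<alpha> t = exp (lam * t)"
  shows "(\<forall>t. metric_eq (pullback (conf_map (\<alpha> t)) g0)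
            (scale_metric (\<lambda>p. (2 * \<alpha> t / ((1 + xi p) + (\<alpha> t)\<^sup>2 * (1 - xi p)))\<^sup>2) g0))
       \<and> (\<forall>u :: real \<Rightarrow> real ^ 3 \<Rightarrow> real.
            (\<forall>t. metric_eq (conf_metric (u t)) (pullback (conf_map (\<alpha> t)) g0))
              \<longrightarrow> geodesic_Gamma1_plus u)"
proof (intro conjI allI impI)
  fix t
  show "metric_eq (pullback (conf_map (\<alpha> t)) g0)
      (scale_metric (\<lambda>p. (2 * \<alpha> t / ((1 + xi p) + (\<alpha> t)\<^sup>2 * (1 - xi p)))\<^sup>2) g0)"
    by (rule pullback_conf_map) (simp add: assms)
next
  fix u :: "real \<Rightarrow> real ^ 3 \<Rightarrow> real"
  assume u: "\<forall>t. metric_eq (conf_metric (u t)) (pullback (conf_map (\<alpha> t)) g0)"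
  \<comment> \<open>The metric determines \<open>u\<close> on \<open>S2\<close>, so an arbitrary
    solution may be compared with the closed form pointwise.\<close>
  have "u t p = conf_path lam t p" if p: "p \<in> S2" for t p
  proof -
    have "metric_eq (conf_metric (u t))
        (scale_metric (\<lambda>p. (2 * \<alpha> t / ((1 + xi p) + (\<alpha> t)\<^sup>2 * (1 - xi p)))\<^sup>2) g0)"
      using u pullback_conf_map[of "\<alpha> t"] by (simp add: metric_eq_def assms)
    from conf_factor_unique[OF this p] have "exp (2 * u t p) = exp (2 * conf_path lam t p)"
      unfolding exp_conf_path[OF p] by (simp add: assms denom_def xi_def)
    then show ?thesis by simp
  qed
  then show "geodesic_Gamma1_plus u" by (rule conf_path_geodesic)
qed

end
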